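(* Let $T>0$ and let $\{X(t),t\in[0,T]\}$ be a stochastic process that is multifractal in the moment sense with scaling function $\tau$. If for some $q>0$ one has $E|X(T)|^q<\infty$ and $\tau(q)>1$, then there exists a modification of $\{X(t)\}$ which is locally Hölder continuous with exponent $\gamma$ for every $$\gamma\in\left(0,\ \frac{\tau(q)}{q}-\frac1q\right).$$ In particular, there exists a modification such that for almost every sample path $$H^-\le H(t)\qquad\text{for each } t\in[0,T],$$ where $H(t)$ is the pointwise Hölder exponent of the path at $t$ and $$H^-=\sup\left\{\frac{\tau(q)}{q}-\frac1q:\ q\in(0,\overline q),\ \tau(q)>1\right\}.$$
   Context: All processes are real-valued, measurable, separable, not a.s. constant, and stochastically continuous at zero, i.e. $P(|X(h)|>\varepsilon)\to0$ as $h\to0$ for every $\varepsilon>0$. Let $\overline q=\sup\{q>0:E|X(T)|^q<\infty\}$ and $\underline q=\inf\{q<0:E|X(T)|^q<\infty\}$ (set equal to $0$ if the corresponding set is empty). The process is multifractal in the moment sense if there exist functions $c(q)$ and $\tau(q)$ on $\mathfrak{Q}=(\underline q,\overline q)$, an interval of positive length, such that $$E|X(t)-X(s)|^q=c(q)|t-s|^{\tau(q)}\quad\text{for all } t,s\in[0,T],\ t\ne s,\ q\in\mathfrak{Q};$$ $\tau$ is called the scaling function. In the claim $q$ is understood to belong to $\mathfrak{Q}$, so that $\tau(q)$ is defined. A process $\{X(t),t\in[0,T]\}$ is locally Hölder continuous with exponent $\gamma$ if there are an a.s. positive random variable $\eta(\omega)$ and a constant $\delta>0$ such that $$P\Big(\omega:\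 \sup_{0<|t-s|<\eta(\omega),\ s,t\in[0,T]}\frac{|X(t,\omega)-X(s,\omega)|}{|t-s|^{\gamma}}\le\delta\Big)=1.$$ A function $f$ is $C^{\gamma}(t_0)$ if there is $C>0$ such that $|f(t)-f(t_0)|\le C|t-t_0|^{\gamma}$ for all $t$ in the domain in some neighbourhood of $t_0$; its pointwise Hölder exponent is $H(t_0)=\sup\{\gamma\ge0:f\in C^{\gamma}(t_0)\}$ with $\sup\emptyset=0$. *)

theory Defs
  imports "HOL-Probability.Probability"
begin

text \<open>A process on \<open>{0..T}\<close> over a probability space \<open>M\<close> is a function \<open>X :: real \<Rightarrow> 'a \<Rightarrow> real\<close> of time
  and sample point; its values at times outside \<open>{0..T}\<close> are irrelevant.\<close>

definition measurable_process :: "'a measure \<Rightarrow> real \<Rightarrow> (real \<Rightarrow> 'a \<Rightarrow> real) \<Rightarrow> bool" where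
  "measurable_process M T X \<longleftrightarrow>
     (\<lambda>(t, \<omega>). X t \<omega>) \<in> borel_measurable (restrict_space borel {0..T} \<Otimes>\<^sub>M M)"

text \<open>Separability in the sense of Doob, in its sequential form. The countable set \<open>D\<close> is
  automatically dense in \<open>{0..T}\<close>.\<close>

definition separable_process :: "'a measure \<Rightarrow> real \<Rightarrow> (real \<Rightarrow> 'a \<Rightarrow> real) \<Rightarrow> bool" where
  "separable_process M T X \<longleftrightarrow>
     (\<exists>D. countable D \<and> D \<subseteq> {0..T} \<and>
       (AE \<omega> in M. \<forall>t\<in>{0..T}. \<exists>u :: nat \<Rightarrow> real.
          (\<forall>n. u n \<in> D) \<and> u \<longlonglongrightarrow> t \<and> (\<lambda>n. X (u n) \<omega>) \<longlonglongrightarrow> X t \<omega>))"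

text \<open>Only processes equal to a deterministic constant count as constant here. This is the weakest
  form of nontriviality: it also holds for every process whose paths are not a.s. constant in time.\<close>

definition as_constant :: "'a measure \<Rightarrow> real \<Rightarrow> (real \<Rightarrow> 'a \<Rightarrow> real) \<Rightarrow> bool" where
  "as_constant M T X \<longleftrightarrow> (\<exists>c. AE \<omega> in M. \<forall>t\<in>{0..T}. X t \<omega> = c)"

definition stoch_continuous_at_zero :: "'a measure \<Rightarrow> real \<Rightarrow> (real \<Rightarrow> 'a \<Rightarrow> real) \<Rightarrow> bool" where
  "stoch_continuous_at_zero M T X \<longleftrightarrow>
     (\<forall>\<epsilon>>0. ((\<lambda>h. measure M {\<omega> \<in> space M. \<bar>X h \<omega>\<bar> > \<epsilon>}) \<longlongrightarrow> 0) (at 0 within {0..T}))"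

definition stoch_process :: "'a measure \<Rightarrow> real \<Rightarrow> (real \<Rightarrow> 'a \<Rightarrow> real) \<Rightarrow> bool" where
  "stoch_process M T X \<longleftrightarrow>
     measurable_process M T X \<and> separable_process M T X \<and>
     \<not> as_constant M T X \<and> stoch_continuous_at_zero M T X"

text \<open>The power \<open>\<bar>x\<bar>\<^sup>q\<close> for real \<open>q\<close> of any sign. The case \<open>x = 0\<close> is separate because \<open>0 powr q = 0\<close>
  for all \<open>q\<close>, which would make negative moments of variables with an atom at 0 finite.\<close>

definition abs_pow :: "real \<Rightarrow> real \<Rightarrow> ennreal" where
  "abs_pow x q =
     (if x = 0 then (if q < 0 then \<infinity> else if q = 0 then 1 else 0) else ennreal (\<bar>x\<bar> powr q))"

definition abs_moment :: "'a measure \<Rightarrow> ('a \<Rightarrow> real) \<Rightarrow> real \<Rightarrow> ennreal" where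
  "abs_moment M Z q = (\<integral>\<^sup>+ \<omega>. abs_pow (Z \<omega>) q \<partial>M)"

definition q_upper :: "'a measure \<Rightarrow> real \<Rightarrow> (real \<Rightarrow> 'a \<Rightarrow> real) \<Rightarrow> ereal" where
  "q_upper M T X =
     (let A = {q. q > 0 \<and> abs_moment M (X T) q < \<infinity>} in if A = {} then 0 else Sup (ereal ` A))"

definition q_lower :: "'a measure \<Rightarrow> real \<Rightarrow> (real \<Rightarrow> 'a \<Rightarrow> real) \<Rightarrow> ereal" where
  "q_lower M T X =
     (let A = {q. q < 0 \<and> abs_moment M (X T) q < \<infinity>} in if A = {} then 0 else Inf (ereal ` A))"

definition moment_range :: "'a measure \<Rightarrow> real \<Rightarrow> (real \<Rightarrow> 'a \<Rightarrow> real) \<Rightarrow> real set" where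
  "moment_range M T X = {q. q_lower M T X < ereal q \<and> ereal q < q_upper M T X}"

text \<open>The condition \<open>0 \<le> c q\<close> is forced for expectations of nonnegative variables; it is stated
  because \<open>ennreal\<close> truncates negative numbers to 0.\<close>

definition multifractal :: "'a measure \<Rightarrow> real \<Rightarrow> (real \<Rightarrow> 'a \<Rightarrow> real) \<Rightarrow> (real \<Rightarrow> real) \<Rightarrow> bool" where
  "multifractal M T X \<tau> \<longleftrightarrow>
     q_lower M T X < q_upper M T X \<and>
     (\<exists>c :: real \<Rightarrow> real. \<forall>q\<in>moment_range M T X. 0 \<le> c q \<and>
        (\<forall>t\<in>{0..T}. \<forall>s\<in>{0..T}. t \<noteq> s \<longrightarrow>
           abs_moment M (\<lambda>\<omega>. X t \<omega> - X s \<omega>) q = ennreal (c q * \<bar>t - s\<bar> powr \<tau> q)))"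

definition modification_of :: "'a measure \<Rightarrow> real \<Rightarrow> (real \<Rightarrow> 'a \<Rightarrow> real) \<Rightarrow> (real \<Rightarrow> 'a \<Rightarrow> real) \<Rightarrow> bool" where
  "modification_of M T X Y \<longleftrightarrow>
     stoch_process M T Y \<and> (\<forall>t\<in>{0..T}. AE \<omega> in M. Y t \<omega> = X t \<omega>)"

definition locally_hoelder :: "'a measure \<Rightarrow> real \<Rightarrow> (real \<Rightarrow> 'a \<Rightarrow> real) \<Rightarrow> real \<Rightarrow> bool" where
  "locally_hoelder M T X \<gamma> \<longleftrightarrow>
     (\<exists>\<eta>\<in>borel_measurable M. \<exists>\<delta>>0. (AE \<omega> in M. (\<eta> \<omega> :: real) > 0) \<and>
        measure M {\<omega> \<in> space M.
          (SUP (s, t) \<in> {(s, t). s \<in> {0..T} \<and> t \<in> {0..T} \<and> 0 < \<bar>t - s\<bar> \<and> \<bar>t - s\<bar> < \<eta> \<omega>}.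
             ereal (\<bar>X t \<omega> - X s \<omega>\<bar> / \<bar>t - s\<bar> powr \<gamma>)) \<le> ereal \<delta>} = 1)"

text \<open>In the next two definitions \<open>S\<close> is the domain of \<open>f\<close>. The filter omits the point \<open>t\<^sub>0\<close> itself,
  where the inequality is trivial.\<close>

definition hoelder_at :: "real set \<Rightarrow> (real \<Rightarrow> real) \<Rightarrow> real \<Rightarrow> real \<Rightarrow> bool" where
  "hoelder_at S f t\<^sub>0 \<gamma> \<longleftrightarrow>
     (\<exists>C>0. \<forall>\<^sub>F t in at t\<^sub>0 within S. \<bar>f t - f t\<^sub>0\<bar> \<le> C * \<bar>t - t\<^sub>0\<bar> powr \<gamma>)"

definition hoelder_exponent :: "real set \<Rightarrow> (real \<Rightarrow> real) \<Rightarrow> real \<Rightarrow> ereal" where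
  "hoelder_exponent S f t\<^sub>0 =
     (let A = {\<gamma>. \<gamma> \<ge> 0 \<and> hoelder_at S f t\<^sub>0 \<gamma>} in if A = {} then 0 else Sup (ereal ` A))"

definition H_minus :: "'a measure \<Rightarrow> real \<Rightarrow> (real \<Rightarrow> 'a \<Rightarrow> real) \<Rightarrow> (real \<Rightarrow> real) \<Rightarrow> ereal" where
  "H_minus M T X \<tau> =
     (SUP q \<in> {q. 0 < q \<and> ereal q < q_upper M T X \<and> \<tau> q > 1}. ereal (\<tau> q / q - 1 / q))"

end

(* Moments and Markov's inequality bound the probability that X changes by more than 2^(-\<gamma> n) over a
   step of length T / 2^n by a multiple of 2^(n (\<gamma> q - \<tau>(q))). Summing over the 2^n steps of the dyadic grid
   leaves a summable bound exactly when \<gamma> < (\<tau>(q) - 1) / q, so by Borel-Cantelli almost surely all grid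
   increments at fine levels are small. Telescoping X along the dyadic floors of t (Kolmogorov-Chentsov
   chaining) gives the Hoelder estimate on the countable separating set, and separability extends it
   to [0, T]: X itself is already almost surely Hoelder. The modification sets X to 0 on the null
   set where the estimate fails for some rational \<gamma> < H^-. *)
theory Submission
  imports Defs
begin

section \<open>Dyadic floors of times in [0, T]\<close>

definition dyadic_index :: "real \<Rightarrow> nat \<Rightarrow> real \<Rightarrow> nat" where
  "dyadic_index T n t = nat \<lfloor>2 ^ n * t / T\<rfloor>"

definition dyadic_floor :: "real \<Rightarrow> nat \<Rightarrow> real \<Rightarrow> real" where
  "dyadic_floor T n t = T * real (dyadic_index T n t) / 2 ^ n"

lemma dyadic_index_bounds:
  assumes "T > 0" "t \<ge> 0"
  shows "real (dyadic_index T n t) \<le> 2 ^ n * t / T"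
    and "2 ^ n * t / T < real (dyadic_index T n t) + 1"
proof -
  have "0 \<le> 2 ^ n * t / T"
    using assms by simp
  then have "real (dyadic_index T n t) = of_int \<lfloor>2 ^ n * t / T\<rfloor>"
    by (simp add: dyadic_index_def)
  then show "real (dyadic_index T n t) \<le> 2 ^ n * t / T"
    and "2 ^ n * t / T < real (dyadic_index T n t) + 1"
    by linarith+
qed

text \<open>Equality occurs at \<open>t = T\<close>, whose floor is the right end of the grid and
  not the left end of a cell.\<close>

lemma dyadic_index_le:
  assumes "T > 0" "t \<in> {0..T}"
  shows "dyadic_index T n t \<le> 2 ^ n"
proof -
  have "2 ^ n * t / T \<le> 2 ^ n"
    using assms by (simp add: divide_simps)
  then have "real (dyadic_index T n t) \<le> real (2 ^ n)"
    unfolding of_nat_power of_nat_numeral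
    using assms by (intro order_trans[OF dyadic_index_bounds(1)]) auto
  then show ?thesis
    unfolding of_nat_le_iff .
qed

text \<open>When the level-n cell containing \<open>t\<close> is halved, \<open>t\<close> falls into
  its left or its right half.\<close>

lemma dyadic_index_Suc:
  assumes "T > 0" "t \<ge> 0"
  shows "dyadic_index T (Suc n) t = 2 * dyadic_index T n t \<or>
         dyadic_index T (Suc n) t = Suc (2 * dyadic_index T n t)"
proof -
  note b = dyadic_index_bounds[OF assms, of n] dyadic_index_bounds[OF assms, of "Suc n"]
  have "2 ^ Suc n * t / T = 2 * (2 ^ n * t / T)"
    by simp
  then have "real (dyadic_index T (Suc n) t) < real (2 * dyadic_index T n t + 2)"
    and "real (2 * dyadic_index T n t) < real (dyadic_index T (Suc n) t + 1)"
    unfolding of_nat_add of_nat_mult of_nat_1 of_nat_numeral using b by linarith+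
  then show ?thesis
    unfolding of_nat_less_iff by linarith
qed

lemma dyadic_index_near:
  assumes "T > 0" "s \<ge> 0" "s \<le> t" "t - s < T / 2 ^ n"
  shows "dyadic_index T n t = dyadic_index T n s \<or>
         dyadic_index T n t = Suc (dyadic_index T n s)"
proof -
  have "t \<ge> 0"
    using assms by simp
  note b = dyadic_index_bounds[OF \<open>T > 0\<close> \<open>t \<ge> 0\<close>, of n]
    dyadic_index_bounds[OF \<open>T > 0\<close> \<open>s \<ge> 0\<close>, of n]
  have "2 ^ n * s / T \<le> 2 ^ n * t / T" "2 ^ n * t / T < 2 ^ n * s / T + 1"
    using assms by (auto simp: field_simps)
  then have "real (dyadic_index T n s) < real (dyadic_index T n t + 1)"
    and "real (dyadic_index T n t) < real (dyadic_index T n s + 2)"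
    unfolding of_nat_add of_nat_1 of_nat_numeral using b by linarith+
  then show ?thesis
    unfolding of_nat_less_iff by linarith
qed

lemma dyadic_floor_in:
  assumes "T > 0" "t \<in> {0..T}"
  shows "dyadic_floor T n t \<in> {0..T}"
proof -
  have "real (dyadic_index T n t) \<le> 2 ^ n"
    using dyadic_index_le[OF assms, of n] by (simp flip: of_nat_le_iff)
  then show ?thesis
    using assms by (simp add: dyadic_floor_def divide_simps)
qed

lemma dyadic_floor_dist:
  assumes "T > 0" "t \<ge> 0"
  shows "\<bar>t - dyadic_floor T n t\<bar> \<le> T / 2 ^ n"
proof -
  have "\<bar>t - dyadic_floor T n t\<bar> = T / 2 ^ n * \<bar>2 ^ n * t / T - real (dyadic_index T n t)\<bar>"
    using assms by (subst abs_mult_pos') (auto simp: dyadic_floor_def right_diff_distrib)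
  also have "\<dots> \<le> T / 2 ^ n"
    using dyadic_index_bounds[OF assms, of n] assms by (intro mult_left_le) auto
  finally show ?thesis .
qed

section \<open>Chaining along dyadic floors for a fixed path\<close>

text \<open>With \<open>r = 2 powr - \<gamma>\<close> the threshold \<open>r ^ n\<close> is the
  \<gamma>-th power of 2^(-n), the size that a \<gamma>-Hoelder function allows, up to a constant,
  over a step of length T / 2^n.\<close>

definition grid_bound :: "real \<Rightarrow> real \<Rightarrow> nat \<Rightarrow> (real \<Rightarrow> real) \<Rightarrow> bool" where
  "grid_bound T r n f \<longleftrightarrow>
     (\<forall>k<2 ^ n. \<bar>f (T * real (Suc k) / 2 ^ n) - f (T * real k / 2 ^ n)\<bar> \<le> r ^ n)"

lemma grid_bound_dyadic_floor_Suc: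
  assumes "T > 0" "t \<in> {0..T}" "r > 0" "grid_bound T r (Suc n) f"
  shows "\<bar>f (dyadic_floor T (Suc n) t) - f (dyadic_floor T n t)\<bar> \<le> r ^ Suc n"
proof -
  let ?k = "dyadic_index T n t"
  have eq: "dyadic_floor T n t = T * real (2 * ?k) / 2 ^ Suc n"
    by (simp add: dyadic_floor_def)
  consider "dyadic_index T (Suc n) t = 2 * ?k" | "dyadic_index T (Suc n) t = Suc (2 * ?k)"
    using dyadic_index_Suc[of T t n] assms by auto
  then show ?thesis
  proof cases
    case 1
    then show ?thesis
      using assms by (simp add: dyadic_floor_def)
  next
    case 2
    \<comment> \<open>The right end of the step is itself a grid index, hence at most
      \<open>2 ^ Suc n\<close>; its left neighbour is therefore strictly below, as
      \<open>grid_bound\<close> requires.\<close>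
    then have "2 * ?k < 2 ^ Suc n"
      using dyadic_index_le[OF assms(1,2), of "Suc n"] by simp
    then have "\<bar>f (T * real (Suc (2 * ?k)) / 2 ^ Suc n) - f (T * real (2 * ?k) / 2 ^ Suc n)\<bar>
      \<le> r ^ Suc n"
      using assms(4) unfolding grid_bound_def by blast
    then show ?thesis
      unfolding eq dyadic_floor_def[of T "Suc n"] 2 .
  qed
qed

lemma grid_bound_dyadic_floor_near:
  assumes "T > 0" "s \<in> {0..T}" "t \<in> {0..T}" "s \<le> t" "t - s < T / 2 ^ n"
    and "r > 0" "grid_bound T r n f"
  shows "\<bar>f (dyadic_floor T n t) - f (dyadic_floor T n s)\<bar> \<le> r ^ n"
proof -
  consider "dyadic_index T n t = dyadic_index T n s"
    | "dyadic_index T n t = Suc (dyadic_index T n s)"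
    using dyadic_index_near[of T s t n] assms by auto
  then show ?thesis
  proof cases
    case 1
    then show ?thesis
      using assms by (simp add: dyadic_floor_def)
  next
    case 2
    then have "dyadic_index T n s < 2 ^ n"
      using dyadic_index_le[OF assms(1,3), of n] by simp
    then show ?thesis
      using assms(7) unfolding grid_bound_def dyadic_floor_def 2 by blast
  qed
qed

text \<open>Telescoping over the levels above n: passing from level m to m + 1 costs at most
  \<open>r ^ Suc m\<close>, so the geometric series starts at \<open>r ^ Suc n\<close>. The
  convergence along floors stands in for continuity of \<open>f\<close> at \<open>t\<close>, which
  is not known in advance.\<close>

lemma chaining_tail:
  assumes "T > 0" "t \<in> {0..T}" "0 < r" "r < 1"
    and grid: "\<And>m. m \<ge> n \<Longrightarrow> grid_bound T r m f"
    and lim: "(\<lambda>m. f (dyadic_floor T m t)) \<longlonglongrightarrow> f t"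
  shows "\<bar>f t - f (dyadic_floor T n t)\<bar> \<le> r ^ Suc n / (1 - r)"
proof -
  \<comment> \<open>The right side is the partial sum r^(n+1) + ... + r^(n+j) in closed
    form.\<close>
  have step: "\<bar>f (dyadic_floor T (n + j) t) - f (dyadic_floor T n t)\<bar>
    \<le> r ^ Suc n * (1 - r ^ j) / (1 - r)" for j
  proof (induction j)
    case 0
    show ?case by simp
  next
    case (Suc j)
    have "\<bar>f (dyadic_floor T (Suc (n + j)) t) - f (dyadic_floor T (n + j) t)\<bar> \<le> r ^ Suc (n + j)"
      using grid by (intro grid_bound_dyadic_floor_Suc assms) auto
    then have "\<bar>f (dyadic_floor T (n + Suc j) t) - f (dyadic_floor T n t)\<bar>
      \<le> r ^ Suc (n + j) + r ^ Suc n * (1 - r ^ j) / (1 - r)"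
      using Suc by simp
    also have "\<dots> = r ^ Suc n * (1 - r ^ Suc j) / (1 - r)"
      using assms by (simp add: field_simps power_add)
    finally show ?case .
  qed
  have bound: "\<bar>f (dyadic_floor T (n + j) t) - f (dyadic_floor T n t)\<bar> \<le> r ^ Suc n / (1 - r)" for j
  proof (rule order_trans[OF step])
    show "r ^ Suc n * (1 - r ^ j) / (1 - r) \<le> r ^ Suc n / (1 - r)"
      using assms by (intro divide_right_mono mult_left_le) auto
  qed
  have "(\<lambda>j. f (dyadic_floor T (j + n) t)) \<longlonglongrightarrow> f t"
    using lim by (rule LIMSEQ_ignore_initial_segment)
  then have "(\<lambda>j. \<bar>f (dyadic_floor T (n + j) t) - f (dyadic_floor T n t)\<bar>)
    \<longlonglongrightarrow> \<bar>f t - f (dyadic_floor T n t)\<bar>"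
    by (intro tendsto_intros) (simp add: add.commute)
  then show ?thesis
    using bound by (intro LIMSEQ_le_const2) auto
qed

lemma exists_dyadic_scale:
  fixes T d :: real
  assumes "0 < d" "d < T / 2 ^ N"
  obtains n where "n \<ge> N" "T / 2 ^ Suc n \<le> d" "d < T / 2 ^ n"
proof -
  obtain k :: nat where "T / d < 2 ^ k"
    using real_arch_pow[of 2 "T / d"] by auto
  then have "T / 2 ^ k \<le> d"
    using assms(1) by (simp add: field_simps)
  define m where "m = (LEAST m. T / 2 ^ m \<le> d)"
  have m: "T / 2 ^ m \<le> d"
    unfolding m_def by (rule LeastI) fact
  have least: "d < T / 2 ^ k" if "k < m" for k
    using not_less_Least[of k "\<lambda>m. T / 2 ^ m \<le> d"] that by (simp add: m_def not_le)
  have "T > 0"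
    using assms order.strict_trans[of 0 d "T / 2 ^ N"] by (simp add: zero_less_divide_iff)
  have "N < m"
  proof (rule ccontr)
    assume "\<not> N < m"
    then have "T / 2 ^ N \<le> T / 2 ^ m"
      using \<open>T > 0\<close> by (intro divide_left_mono) auto
    then show False
      using m assms by simp
  qed
  \<comment> \<open>The scale is the last one before \<open>m\<close>. The inequality
    \<open>N < m\<close> both excludes \<open>m = 0\<close> and gives
    \<open>m - 1 \<ge> N\<close>.\<close>
  then show thesis
    using that[of "m - 1"] m least[of "m - 1"] by (cases m) auto
qed

text \<open>At the level n with T / 2^(n+1) \<le> |t - s| < T / 2^n, the path from \<open>s\<close>
  to \<open>t\<close> runs through the two floors: one grid step at most, costing r^n, and two
  tails. The total is r^n (1 + r) / (1 - r), and 1 + r \<le> 2 gives the constant.\<close>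

lemma chaining:
  assumes "T > 0" "\<gamma> > 0" "s \<in> {0..T}" "t \<in> {0..T}" "\<bar>t - s\<bar> < T / 2 ^ N"
    and grid: "\<And>m. m \<ge> N \<Longrightarrow> grid_bound T (2 powr - \<gamma>) m f"
    and "(\<lambda>m. f (dyadic_floor T m s)) \<longlonglongrightarrow> f s"
    and "(\<lambda>m. f (dyadic_floor T m t)) \<longlonglongrightarrow> f t"
  shows "\<bar>f t - f s\<bar> \<le> 2 / (1 - 2 powr - \<gamma>) * (2 / T) powr \<gamma> * \<bar>t - s\<bar> powr \<gamma>"
  using assms(3,4,5,7,8)
proof (induction s t rule: linorder_wlog)
  case (sym s t)
  then show ?case
    by (simp add: abs_minus_commute)
next
  case (le s t)
  define r :: real where "r = 2 powr - \<gamma>"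
  have r: "0 < r" "r < 1"
    using assms by (auto simp: r_def powr_less_one)
  show ?case
  proof (cases "s = t")
    case True
    then show ?thesis by simp
  next
    case False
    then have "0 < t - s" "t - s < T / 2 ^ N"
      using le by auto
    then obtain n where n: "n \<ge> N" "T / 2 ^ Suc n \<le> t - s" "t - s < T / 2 ^ n"
      by (rule exists_dyadic_scale)
    have grid': "grid_bound T r m f" if "m \<ge> n" for m
      using grid[of m] that n by (simp add: r_def)
    have "\<bar>f (dyadic_floor T n t) - f (dyadic_floor T n s)\<bar> \<le> r ^ n"
      using le n r grid'[of n] assms(1) by (intro grid_bound_dyadic_floor_near) auto
    moreover have "\<bar>f t - f (dyadic_floor T n t)\<bar> \<le> r ^ Suc n / (1 - r)"
      using le by (intro chaining_tail grid' r assms) auto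
    moreover have "\<bar>f s - f (dyadic_floor T n s)\<bar> \<le> r ^ Suc n / (1 - r)"
      using le by (intro chaining_tail grid' r assms) auto
    ultimately have "\<bar>f t - f s\<bar> \<le> r ^ n + 2 * (r ^ Suc n / (1 - r))"
      by linarith
    also have "\<dots> = r ^ n * (1 + r) / (1 - r)"
      using r by (simp add: field_simps)
    also have "\<dots> \<le> r ^ n * 2 / (1 - r)"
      using r by (intro divide_right_mono mult_left_mono) auto
    \<comment> \<open>This converts the level into a distance: 2^(-n) is 2 / T times T / 2^(n+1),
      which is at most \<open>t - s\<close>.\<close>
    also have "r ^ n = (2 / T * (T / 2 ^ Suc n)) powr \<gamma>"
    proof -
      have "r ^ n = (2 powr (- real n)) powr \<gamma>"
        unfolding powr_powr by (simp add: r_def powr_power mult.commute)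
      also have "2 powr (- real n) = 2 / T * (T / 2 ^ Suc n)"
        using assms(1) by (simp add: powr_minus powr_realpow divide_simps)
      finally show ?thesis .
    qed
    also have "\<dots> * 2 / (1 - r) \<le> (2 / T * (t - s)) powr \<gamma> * 2 / (1 - r)"
      using r n assms(1,2)
      by (intro divide_right_mono mult_right_mono powr_mono2 mult_left_mono) auto
    also have "\<dots> = 2 / (1 - r) * (2 / T) powr \<gamma> * \<bar>t - s\<bar> powr \<gamma>"
      using assms(1) \<open>0 < t - s\<close> by (subst powr_mult) auto
    finally show ?thesis
      by (simp add: r_def)
  qed
qed

section \<open>Tail bounds from moments\<close>

lemma abs_pow_pos: "q > 0 \<Longrightarrow> abs_pow x q = ennreal (\<bar>x\<bar> powr q)"
  by (simp add: abs_pow_def)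

text \<open>Markov's inequality for |Z|^q. It is stated in \<open>ennreal\<close>, where an infinite
  moment is allowed.\<close>

lemma emeasure_abs_gt_le_abs_moment:
  assumes [measurable]: "Z \<in> borel_measurable M" and "a > 0" "q > 0"
  shows "emeasure M {\<omega> \<in> space M. a < \<bar>Z \<omega>\<bar>} \<le> ennreal (a powr - q) * abs_moment M Z q"
proof -
  have "1 \<le> ennreal (a powr - q) * ennreal (\<bar>Z \<omega>\<bar> powr q)" if "a < \<bar>Z \<omega>\<bar>" for \<omega>
  proof -
    have "a powr q \<le> \<bar>Z \<omega>\<bar> powr q"
      using that assms by (intro powr_mono2) auto
    then have "1 \<le> a powr - q * \<bar>Z \<omega>\<bar> powr q"
      using assms by (simp add: powr_minus field_simps)
    then show ?thesis
      by (simp flip: ennreal_mult)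
  qed
  then have "emeasure M {\<omega> \<in> space M. a < \<bar>Z \<omega>\<bar>} \<le>
      emeasure M {\<omega> \<in> space M. 1 \<le> ennreal (a powr - q) * ennreal (\<bar>Z \<omega>\<bar> powr q)}"
    by (intro emeasure_mono) auto
  also have "\<dots> \<le> ennreal (a powr - q) *
      (\<integral>\<^sup>+\<omega>. ennreal (\<bar>Z \<omega>\<bar> powr q) * indicator (space M) \<omega> \<partial>M)"
    by (intro nn_integral_Markov_inequality) auto
  also have "(\<integral>\<^sup>+\<omega>. ennreal (\<bar>Z \<omega>\<bar> powr q) * indicator (space M) \<omega> \<partial>M) = abs_moment M Z q"
    unfolding abs_moment_def using assms by (intro nn_integral_cong) (simp add: abs_pow_pos)
  finally show ?thesis .
qed

text \<open>The right side of Markov's inequality at threshold 2^(-\<gamma> n): the threshold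
  contributes 2^(n \<gamma> q) and the step length T^b 2^(-n b), which together are geometric in
  n.\<close>

lemma dyadic_moment_bound:
  fixes T b \<gamma> q c h :: real
  assumes "T > 0" "b > 0" "c \<ge> 0" "0 \<le> h" "h \<le> T / 2 ^ n"
  shows "((2 powr - \<gamma>) ^ n) powr - q * (c * h powr b)
    \<le> c * T powr b * (2 powr (\<gamma> * q - b)) ^ n"
proof -
  have scale: "(T / 2 ^ n) powr b = T powr b * 2 powr (- (real n * b))"
    using assms by (simp add: powr_divide powr_minus_divide powr_powr flip: powr_realpow)
  have level: "((2 powr - \<gamma>) ^ n) powr - q = 2 powr (real n * \<gamma> * q)"
    by (simp add: powr_power powr_powr mult_ac)
  have "((2 powr - \<gamma>) ^ n) powr - q * (c * h powr b)
    \<le> ((2 powr - \<gamma>) ^ n) powr - q * (c * (T / 2 ^ n) powr b)"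
    using assms by (intro mult_left_mono powr_mono2) auto
  also have "\<dots> = c * T powr b * 2 powr (real n * (\<gamma> * q - b))"
    unfolding scale level
    by (simp add: right_diff_distrib powr_diff powr_minus divide_inverse mult_ac)
  also have "\<dots> = c * T powr b * (2 powr (\<gamma> * q - b)) ^ n"
    by (simp add: powr_power mult.commute)
  finally show ?thesis .
qed

section \<open>Almost sure Hoelder estimate from one moment bound\<close>

text \<open>The Kolmogorov-Chentsov setting, with \<open>b\<close> in the role of \<tau>(q). The
  condition \<open>\<gamma> * q < b - 1\<close> says \<gamma> < (b - 1) / q.\<close>

locale moment_increments = prob_space M for M :: "'a measure" +
  fixes T :: real and X :: "real \<Rightarrow> 'a \<Rightarrow> real" and q b c \<gamma> :: real
  assumes T_pos: "T > 0" and q_pos: "q > 0" and c_nonneg: "c \<ge> 0"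
    and \<gamma>_pos: "\<gamma> > 0" and \<gamma>_less: "\<gamma> * q < b - 1"
    and rv [measurable]: "\<And>t. t \<in> {0..T} \<Longrightarrow> X t \<in> borel_measurable M"
    and moment: "\<And>s t. s \<in> {0..T} \<Longrightarrow> t \<in> {0..T} \<Longrightarrow>
      abs_moment M (\<lambda>\<omega>. X t \<omega> - X s \<omega>) q \<le> ennreal (c * \<bar>t - s\<bar> powr b)"
begin

text \<open>The two times are arbitrary up to their distance, because the bound serves both
  neighbouring grid points and a time paired with its dyadic floor.\<close>

lemma prob_increment_gt:
  assumes "s \<in> {0..T}" "t \<in> {0..T}" "\<bar>t - s\<bar> \<le> T / 2 ^ n"
  shows "prob {\<omega> \<in> space M. (2 powr - \<gamma>) ^ n < \<bar>X t \<omega> - X s \<omega>\<bar>}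
    \<le> c * T powr b * (2 powr (\<gamma> * q - b)) ^ n"
proof -
  have [measurable]: "X s \<in> borel_measurable M" "X t \<in> borel_measurable M"
    using assms rv by auto
  have "b > 0"
    using \<gamma>_less mult_pos_pos[OF \<gamma>_pos q_pos] by linarith
  have "emeasure M {\<omega> \<in> space M. (2 powr - \<gamma>) ^ n < \<bar>X t \<omega> - X s \<omega>\<bar>}
    \<le> ennreal (((2 powr - \<gamma>) ^ n) powr - q) * abs_moment M (\<lambda>\<omega>. X t \<omega> - X s \<omega>) q"
    using q_pos by (intro emeasure_abs_gt_le_abs_moment) auto
  also have "\<dots> \<le> ennreal (((2 powr - \<gamma>) ^ n) powr - q) * ennreal (c * \<bar>t - s\<bar> powr b)"
    using assms by (intro mult_left_mono moment) auto
  also have "\<dots> = ennreal (((2 powr - \<gamma>) ^ n) powr - q * (c * \<bar>t - s\<bar> powr b))"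
    using c_nonneg by (intro ennreal_mult[symmetric]) auto
  also have "\<dots> \<le> ennreal (c * T powr b * (2 powr (\<gamma> * q - b)) ^ n)"
    using assms T_pos c_nonneg \<open>b > 0\<close> by (intro ennreal_leI dyadic_moment_bound) auto
  finally show ?thesis
    unfolding emeasure_eq_measure using c_nonneg by (subst (asm) ennreal_le_iff) auto
qed

lemma summable_dyadic_bound: "summable (\<lambda>n. c * T powr b * (2 powr (\<gamma> * q - b)) ^ n)"
  using \<gamma>_less by (intro summable_mult summable_geometric) (auto simp: powr_less_one)

lemma grid_point_in:
  assumes "k \<le> 2 ^ n"
  shows "T * real k / 2 ^ n \<in> {0..T}"
proof -
  have "real k \<le> real (2 ^ n)"
    using assms unfolding of_nat_le_iff .
  then show ?thesis
    using T_pos by (simp add: divide_simps)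
qed

text \<open>A finite conjunction over grid points in [0, T]. It makes the bad events of
  Borel-Cantelli and the random level in \<open>AE_hoelder\<close> measurable.\<close>

lemma measurable_grid_bound [measurable]:
  "Measurable.pred M (\<lambda>\<omega>. grid_bound T r n (\<lambda>t. X t \<omega>))"
proof -
  have "Measurable.pred M (\<lambda>\<omega>. \<bar>X (T * real (Suc k) / 2 ^ n) \<omega> - X (T * real k / 2 ^ n) \<omega>\<bar> \<le> r ^ n)"
    if "k \<in> {..<2 ^ n}" for k
  proof -
    have [measurable]: "X (T * real (Suc k) / 2 ^ n) \<in> borel_measurable M"
      "X (T * real k / 2 ^ n) \<in> borel_measurable M"
      using that by (intro rv grid_point_in; simp)+
    show ?thesis
      by measurable
  qed
  then have "Measurable.pred M (\<lambda>\<omega>. \<forall>k\<in>{..<2 ^ n}.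
      \<bar>X (T * real (Suc k) / 2 ^ n) \<omega> - X (T * real k / 2 ^ n) \<omega>\<bar> \<le> r ^ n)"
    by (intro pred_intros_finite) auto
  then show ?thesis
    unfolding grid_bound_def by (simp only: lessThan_iff Ball_def)
qed

text \<open>The union bound over 2^n cells doubles the ratio of the geometric bound; this is the
  origin of the 1 in \<open>b - 1\<close>.\<close>

lemma prob_not_grid_bound:
  "prob {\<omega> \<in> space M. \<not> grid_bound T (2 powr - \<gamma>) n (\<lambda>t. X t \<omega>)}
    \<le> c * T powr b * (2 * 2 powr (\<gamma> * q - b)) ^ n"
proof -
  define E where "E k = {\<omega> \<in> space M. (2 powr - \<gamma>) ^ n <
    \<bar>X (T * real (Suc k) / 2 ^ n) \<omega> - X (T * real k / 2 ^ n) \<omega>\<bar>}" for k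
  have "E k \<in> events" if "k < 2 ^ n" for k
  proof -
    have [measurable]: "X (T * real (Suc k) / 2 ^ n) \<in> borel_measurable M"
      "X (T * real k / 2 ^ n) \<in> borel_measurable M"
      using that by (intro rv grid_point_in; simp)+
    show ?thesis
      unfolding E_def by measurable
  qed
  then have "prob (\<Union>k<2 ^ n. E k) \<le> (\<Sum>k<2 ^ n. prob (E k))"
    by (intro finite_measure_subadditive_finite) auto
  also have "\<dots> \<le> (\<Sum>k<(2::nat) ^ n. c * T powr b * (2 powr (\<gamma> * q - b)) ^ n)"
  proof (intro sum_mono)
    fix k :: nat assume "k \<in> {..<2 ^ n}"
    moreover have "T * real (Suc k) / 2 ^ n - T * real k / 2 ^ n = T / 2 ^ n"
      by (simp add: field_simps)
    ultimately show "prob (E k) \<le> c * T powr b * (2 powr (\<gamma> * q - b)) ^ n"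
      unfolding E_def using T_pos by (intro prob_increment_gt grid_point_in) auto
  qed
  also have "\<dots> = c * T powr b * (2 * 2 powr (\<gamma> * q - b)) ^ n"
    by (simp add: power_mult_distrib)
  also have "(\<Union>k<2 ^ n. E k) = {\<omega> \<in> space M. \<not> grid_bound T (2 powr - \<gamma>) n (\<lambda>t. X t \<omega>)}"
    by (auto simp: E_def grid_bound_def not_le)
  finally show ?thesis .
qed

lemma AE_eventually_grid_bound:
  "AE \<omega> in M. \<forall>\<^sub>F n in sequentially. grid_bound T (2 powr - \<gamma>) n (\<lambda>t. X t \<omega>)"
proof -
  have "2 * 2 powr (\<gamma> * q - b) = 2 powr (\<gamma> * q - (b - 1))"
    by (simp add: powr_add[symmetric] powr_diff)
  also have "\<dots> < 1"
    using \<gamma>_less by (simp add: powr_less_one)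
  finally have "summable (\<lambda>n. c * T powr b * (2 * 2 powr (\<gamma> * q - b)) ^ n)"
    by (intro summable_mult summable_geometric) auto
  then have "summable (\<lambda>n. prob {\<omega> \<in> space M. \<not> grid_bound T (2 powr - \<gamma>) n (\<lambda>t. X t \<omega>)})"
    by (rule summable_comparison_test') (use prob_not_grid_bound in auto)
  then have "AE \<omega> in M. \<forall>\<^sub>F n in sequentially.
      \<omega> \<in> space M - {\<omega> \<in> space M. \<not> grid_bound T (2 powr - \<gamma>) n (\<lambda>t. X t \<omega>)}"
    by (intro borel_cantelli_AE1) (auto simp: emeasure_eq_measure)
  then show ?thesis
    by (rule AE_mp) (auto elim: eventually_mono)
qed

text \<open>Borel-Cantelli for one event per level, so no union bound enters. The exceptional null
  set depends on \<open>t\<close>, which restricts simultaneous use to countably many times.\<close>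

lemma AE_dyadic_floor_tendsto:
  assumes "t \<in> {0..T}"
  shows "AE \<omega> in M. (\<lambda>n. X (dyadic_floor T n t) \<omega>) \<longlonglongrightarrow> X t \<omega>"
proof -
  let ?r = "2 powr - \<gamma>"
  define A where "A n = {\<omega> \<in> space M. ?r ^ n < \<bar>X t \<omega> - X (dyadic_floor T n t) \<omega>\<bar>}" for n
  have "A n \<in> events" for n
  proof -
    have [measurable]: "X t \<in> borel_measurable M" "X (dyadic_floor T n t) \<in> borel_measurable M"
      using assms T_pos by (intro rv dyadic_floor_in; simp)+
    show ?thesis
      unfolding A_def by measurable
  qed
  moreover have "summable (\<lambda>n. prob (A n))"
  proof (rule summable_comparison_test'[OF summable_dyadic_bound])
    show "norm (prob (A n)) \<le> c * T powr b * (2 powr (\<gamma> * q - b)) ^ n" for n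
      using assms T_pos prob_increment_gt[of "dyadic_floor T n t" t n, folded A_def]
        dyadic_floor_in[of T t n] dyadic_floor_dist[of T t n] by simp
  qed
  ultimately have "AE \<omega> in M. \<forall>\<^sub>F n in sequentially. \<omega> \<in> space M - A n"
    by (intro borel_cantelli_AE1) (simp_all add: emeasure_eq_measure)
  then show ?thesis
  proof (rule AE_mp, intro AE_I2 impI)
    fix \<omega> assume "\<forall>\<^sub>F n in sequentially. \<omega> \<in> space M - A n"
    then have "\<forall>\<^sub>F n in sequentially. norm (X (dyadic_floor T n t) \<omega> - X t \<omega>) \<le> ?r ^ n"
      by (rule eventually_mono) (auto simp: A_def not_less abs_minus_commute)
    moreover have "(\<lambda>n. ?r ^ n) \<longlonglongrightarrow> 0"
      using \<gamma>_pos by (intro LIMSEQ_power_zero) (simp add: powr_less_one)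
    ultimately show "(\<lambda>n. X (dyadic_floor T n t) \<omega>) \<longlonglongrightarrow> X t \<omega>"
      by (rule LIM_zero_cancel[OF Lim_null_comparison])
  qed
qed

lemma AE_hoelder:
  assumes "separable_process M T X"
  obtains \<eta> \<delta> where "\<eta> \<in> borel_measurable M" "\<And>\<omega>. \<eta> \<omega> > 0" "\<delta> > 0"
    "AE \<omega> in M. \<forall>s\<in>{0..T}. \<forall>t\<in>{0..T}. \<bar>t - s\<bar> < \<eta> \<omega> \<longrightarrow>
       \<bar>X t \<omega> - X s \<omega>\<bar> \<le> \<delta> * \<bar>t - s\<bar> powr \<gamma>"
proof
  let ?grid = "\<lambda>\<omega> m. grid_bound T (2 powr - \<gamma>) m (\<lambda>t. X t \<omega>)"
  \<comment> \<open>The first level from which all grid bounds hold. Where no such level exists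
    \<open>LEAST\<close> is unspecified, but \<open>\<eta>\<close> is positive all the same.\<close>
  define N where "N \<omega> = (LEAST N. \<forall>m\<ge>N. ?grid \<omega> m)" for \<omega>
  define \<eta> where "\<eta> \<omega> = T / 2 ^ N \<omega>" for \<omega>
  \<comment> \<open>The constant of \<open>chaining\<close>; it does not depend on the sample point,
    as \<open>locally_hoelder\<close> demands, so all randomness sits in
    \<open>\<eta>\<close>.\<close>
  define \<delta> where "\<delta> = 2 / (1 - 2 powr - \<gamma>) * (2 / T) powr \<gamma>"
  have "N \<in> M \<rightarrow>\<^sub>M count_space UNIV"
    unfolding N_def by measurable
  then show "\<eta> \<in> borel_measurable M"
    unfolding \<eta>_def by measurable
  show "\<eta> \<omega> > 0" for \<omega>
    using T_pos by (simp add: \<eta>_def)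
  show "\<delta> > 0"
    using T_pos \<gamma>_pos by (simp add: \<delta>_def powr_less_one)
  obtain D where D: "countable D" "D \<subseteq> {0..T}"
    and sep: "AE \<omega> in M. \<forall>t\<in>{0..T}. \<exists>u :: nat \<Rightarrow> real.
      (\<forall>n. u n \<in> D) \<and> u \<longlonglongrightarrow> t \<and> (\<lambda>n. X (u n) \<omega>) \<longlonglongrightarrow> X t \<omega>"
    using assms unfolding separable_process_def by blast
  \<comment> \<open>Countability of \<open>D\<close> gives one null set for all its points.\<close>
  have "AE \<omega> in M. \<forall>t\<in>D. (\<lambda>n. X (dyadic_floor T n t) \<omega>) \<longlonglongrightarrow> X t \<omega>"
    using D AE_dyadic_floor_tendsto by (subst AE_ball_countable) auto
  with sep AE_eventually_grid_bound
  show "AE \<omega> in M. \<forall>s\<in>{0..T}. \<forall>t\<in>{0..T}. \<bar>t - s\<bar> < \<eta> \<omega> \<longrightarrow>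
    \<bar>X t \<omega> - X s \<omega>\<bar> \<le> \<delta> * \<bar>t - s\<bar> powr \<gamma>"
  proof eventually_elim
    case (elim \<omega>)
    have grid: "?grid \<omega> m" if "m \<ge> N \<omega>" for m
    proof -
      have "\<exists>N. \<forall>m\<ge>N. ?grid \<omega> m"
        using elim(2) by (simp only: eventually_sequentially)
      then have "\<forall>m\<ge>N \<omega>. ?grid \<omega> m"
        unfolding N_def by (rule LeastI_ex)
      then show ?thesis
        using that by blast
    qed
    have on_D: "\<bar>X t \<omega> - X s \<omega>\<bar> \<le> \<delta> * \<bar>t - s\<bar> powr \<gamma>"
      if "s \<in> D" "t \<in> D" "\<bar>t - s\<bar> < \<eta> \<omega>" for s t
      unfolding \<delta>_def using that D elim(3)
      by (intro chaining[OF T_pos \<gamma>_pos _ _ _ grid]) (auto simp: \<eta>_def)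
    show ?case
    proof (intro ballI impI)
      fix s t assume st: "s \<in> {0..T}" "t \<in> {0..T}" "\<bar>t - s\<bar> < \<eta> \<omega>"
      obtain u where u: "\<And>n. u n \<in> D" "u \<longlonglongrightarrow> s" "(\<lambda>n. X (u n) \<omega>) \<longlonglongrightarrow> X s \<omega>"
        using elim(1) st by blast
      obtain v where v: "\<And>n. v n \<in> D" "v \<longlonglongrightarrow> t" "(\<lambda>n. X (v n) \<omega>) \<longlonglongrightarrow> X t \<omega>"
        using elim(1) st by blast
      have dist: "(\<lambda>n. \<bar>v n - u n\<bar>) \<longlonglongrightarrow> \<bar>t - s\<bar>"
        by (intro tendsto_intros u v)
      show "\<bar>X t \<omega> - X s \<omega>\<bar> \<le> \<delta> * \<bar>t - s\<bar> powr \<gamma>"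
      proof (rule tendsto_le[OF trivial_limit_sequentially])
        \<comment> \<open>The case \<open>s = t\<close> is included: the base may tend to 0, where
          continuity of \<open>powr\<close> rests on \<gamma> > 0.\<close>
        show "(\<lambda>n. \<delta> * \<bar>v n - u n\<bar> powr \<gamma>) \<longlonglongrightarrow> \<delta> * \<bar>t - s\<bar> powr \<gamma>"
          using \<gamma>_pos by (intro tendsto_intros tendsto_powr' dist) auto
        show "(\<lambda>n. \<bar>X (v n) \<omega> - X (u n) \<omega>\<bar>) \<longlonglongrightarrow> \<bar>X t \<omega> - X s \<omega>\<bar>"
          by (intro tendsto_intros u v)
        \<comment> \<open>The strict inequality \<open>\<bar>t - s\<bar> < \<eta> \<omega>\<close>
          is inherited by the approximating pairs for all large n.\<close>
        show "\<forall>\<^sub>F n in sequentially. \<bar>X (v n) \<omega> - X (u n) \<omega>\<bar> \<le> \<delta> * \<bar>v n - u n\<bar> powr \<gamma>"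
          using order_tendstoD(2)[OF dist st(3)] by eventually_elim (intro on_D u v)
      qed
    qed
  qed
qed

end

section \<open>Modifications that vanish on a null set\<close>

lemma AE_Bex_null_set:
  assumes "AE \<omega> in M. P \<omega>"
  shows "\<exists>N\<in>null_sets M. \<forall>\<omega>\<in>space M - N. P \<omega>"
  using assms by (auto simp: eventually_ae_filter)

text \<open>A modification that vanishes on \<open>N\<close>. Having the Hoelder estimate at every sample point, not only
  almost everywhere, makes the event in \<open>locally_hoelder\<close> the whole space, hence measurable; on a
  non-measurable set \<open>measure\<close> would give 0.\<close>

definition off_null :: "'a set \<Rightarrow> (real \<Rightarrow> 'a \<Rightarrow> real) \<Rightarrow> real \<Rightarrow> 'a \<Rightarrow> real" where
  "off_null N X t \<omega> = (if \<omega> \<in> N then 0 else X t \<omega>)"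

lemma measurable_process_section:
  assumes "measurable_process M T X" "t \<in> {0..T}"
  shows "X t \<in> borel_measurable M"
proof -
  have "Pair t \<in> M \<rightarrow>\<^sub>M restrict_space borel {0..T} \<Otimes>\<^sub>M M"
    using assms(2) by (intro measurable_Pair1') (simp add: space_restrict_space)
  from measurable_compose[OF this assms(1)[unfolded measurable_process_def]]
  show ?thesis
    by simp
qed

lemma measurable_process_off_null:
  assumes X: "measurable_process M T X" and N [measurable]: "N \<in> sets M"
  shows "measurable_process M T (off_null N X)"
proof -
  let ?P = "restrict_space borel {0..T} \<Otimes>\<^sub>M M"
  have [measurable]: "(\<lambda>(t, \<omega>). X t \<omega>) \<in> borel_measurable ?P"
    using X by (simp add: measurable_process_def)
  have "(\<lambda>p. if snd p \<in> N then 0 else (case p of (t, \<omega>) \<Rightarrow> X t \<omega>)) \<in> borel_measurable ?P"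
    by measurable
  also have "(\<lambda>p. if snd p \<in> N then 0 else (case p of (t, \<omega>) \<Rightarrow> X t \<omega>))
    = (\<lambda>(t, \<omega>). off_null N X t \<omega>)"
    by (auto simp: off_null_def)
  finally show ?thesis
    by (simp add: measurable_process_def)
qed

text \<open>Off \<open>N\<close> the paths agree at all times at once, so separability carries over
  with the same \<open>D\<close>, and so does not being constant. For stochastic continuity the
  events at each time differ by a null set only.\<close>

lemma modification_of_off_null:
  assumes X: "stoch_process M T X" and N: "N \<in> null_sets M" and "T > 0"
  shows "modification_of M T X (off_null N X)"
proof -
  let ?Y = "off_null N X"
  have eq: "AE \<omega> in M. \<forall>t. ?Y t \<omega> = X t \<omega>"
    using AE_not_in[OF N] by eventually_elim (simp add: off_null_def)
  have mX: "measurable_process M T X"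
    using X by (simp add: stoch_process_def)
  have mY: "measurable_process M T ?Y"
    using mX N by (intro measurable_process_off_null) auto
  have "separable_process M T ?Y"
  proof -
    obtain D where "countable D" "D \<subseteq> {0..T}"
      and D: "AE \<omega> in M. \<forall>t\<in>{0..T}. \<exists>u :: nat \<Rightarrow> real.
        (\<forall>n. u n \<in> D) \<and> u \<longlonglongrightarrow> t \<and> (\<lambda>n. X (u n) \<omega>) \<longlonglongrightarrow> X t \<omega>"
      using X unfolding stoch_process_def separable_process_def by blast
    moreover from D eq have "AE \<omega> in M. \<forall>t\<in>{0..T}. \<exists>u :: nat \<Rightarrow> real.
        (\<forall>n. u n \<in> D) \<and> u \<longlonglongrightarrow> t \<and> (\<lambda>n. ?Y (u n) \<omega>) \<longlonglongrightarrow> ?Y t \<omega>"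
      by eventually_elim simp
    ultimately show ?thesis
      unfolding separable_process_def by blast
  qed
  moreover have "\<not> as_constant M T ?Y"
  proof
    assume "as_constant M T ?Y"
    then obtain k where "AE \<omega> in M. \<forall>t\<in>{0..T}. ?Y t \<omega> = k"
      unfolding as_constant_def by blast
    with eq have "AE \<omega> in M. \<forall>t\<in>{0..T}. X t \<omega> = k"
      by eventually_elim simp
    then show False
      using X unfolding stoch_process_def as_constant_def by blast
  qed
  moreover have "stoch_continuous_at_zero M T ?Y"
    unfolding stoch_continuous_at_zero_def
  proof (intro allI impI)
    fix \<epsilon> :: real assume "\<epsilon> > 0"
    then have "((\<lambda>h. measure M {\<omega> \<in> space M. \<bar>X h \<omega>\<bar> > \<epsilon>}) \<longlongrightarrow> 0) (at 0 within {0..T})"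
      using X unfolding stoch_process_def stoch_continuous_at_zero_def by blast
    moreover have "measure M {\<omega> \<in> space M. \<bar>X h \<omega>\<bar> > \<epsilon>} = measure M {\<omega> \<in> space M. \<bar>?Y h \<omega>\<bar> > \<epsilon>}"
      if "h \<in> {0..T}" for h
    proof (rule measure_eq_AE)
      note [measurable] = measurable_process_section[OF mX that] measurable_process_section[OF mY that]
      show "AE \<omega> in M. \<omega> \<in> {\<omega> \<in> space M. \<bar>X h \<omega>\<bar> > \<epsilon>} \<longleftrightarrow> \<omega> \<in> {\<omega> \<in> space M. \<bar>?Y h \<omega>\<bar> > \<epsilon>}"
        using eq by eventually_elim simp
      show "{\<omega> \<in> space M. \<bar>X h \<omega>\<bar> > \<epsilon>} \<in> sets M" "{\<omega> \<in> space M. \<bar>?Y h \<omega>\<bar> > \<epsilon>} \<in> sets M"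
        by measurable
    qed
    ultimately show "((\<lambda>h. measure M {\<omega> \<in> space M. \<bar>?Y h \<omega>\<bar> > \<epsilon>}) \<longlongrightarrow> 0) (at 0 within {0..T})"
      by (auto intro: Lim_transform_within[OF _ zero_less_one])
  qed
  ultimately have "stoch_process M T ?Y"
    using mY by (simp add: stoch_process_def)
  moreover have "AE \<omega> in M. ?Y t \<omega> = X t \<omega>" for t
    using eq by eventually_elim simp
  ultimately show ?thesis
    by (simp add: modification_of_def)
qed

section \<open>From path estimates to Hoelder notions\<close>

definition hoelder_path :: "real \<Rightarrow> (real \<Rightarrow> real) \<Rightarrow> real \<Rightarrow> real \<Rightarrow> real \<Rightarrow> bool" where
  "hoelder_path T f \<eta> \<delta> \<gamma> \<longleftrightarrow> (\<forall>s\<in>{0..T}. \<forall>t\<in>{0..T}. \<bar>t - s\<bar> < \<eta> \<longrightarrow>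
     \<bar>f t - f s\<bar> \<le> \<delta> * \<bar>t - s\<bar> powr \<gamma>)"

text \<open>For distances up to 1 a smaller exponent gives a larger power; hence the cap at
  1.\<close>

lemma hoelder_path_mono:
  assumes "hoelder_path T f \<eta> \<delta> \<gamma>'" "\<gamma> \<le> \<gamma>'" "\<delta> > 0"
  shows "hoelder_path T f (min \<eta> 1) \<delta> \<gamma>"
  unfolding hoelder_path_def
proof (intro ballI impI)
  fix s t assume st: "s \<in> {0..T}" "t \<in> {0..T}" "\<bar>t - s\<bar> < min \<eta> 1"
  then have "\<bar>f t - f s\<bar> \<le> \<delta> * \<bar>t - s\<bar> powr \<gamma>'"
    using assms(1) by (auto simp: hoelder_path_def)
  also have "\<dots> \<le> \<delta> * \<bar>t - s\<bar> powr \<gamma>"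
    using st assms by (intro mult_left_mono powr_mono') auto
  finally show "\<bar>f t - f s\<bar> \<le> \<delta> * \<bar>t - s\<bar> powr \<gamma>" .
qed

lemma hoelder_path_imp_hoelder_at:
  assumes "hoelder_path T f \<eta> \<delta> \<gamma>" "\<eta> > 0" "\<delta> > 0" "t \<in> {0..T}"
  shows "hoelder_at {0..T} f t \<gamma>"
  unfolding hoelder_at_def
proof (intro exI conjI)
  show "\<forall>\<^sub>F s in at t within {0..T}. \<bar>f s - f t\<bar> \<le> \<delta> * \<bar>s - t\<bar> powr \<gamma>"
    unfolding eventually_at using assms by (auto simp: hoelder_path_def dist_real_def)
qed fact

lemma hoelder_exponent_ge:
  assumes "hoelder_at S f t \<gamma>" "\<gamma> \<ge> 0"
  shows "ereal \<gamma> \<le> hoelder_exponent S f t"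
  using assms unfolding hoelder_exponent_def Let_def by (auto intro!: Sup_upper)

text \<open>With the estimate at every sample point, the event of \<open>locally_hoelder\<close> is
  all of \<open>space M\<close>. This settles its measurability although the supremum runs over
  uncountably many pairs.\<close>

lemma locally_hoelderI:
  assumes "prob_space M" "\<eta> \<in> borel_measurable M" "\<And>\<omega>. \<eta> \<omega> > 0" "\<delta> > 0"
    and path: "\<And>\<omega>. \<omega> \<in> space M \<Longrightarrow> hoelder_path T (\<lambda>t. Y t \<omega>) (\<eta> \<omega>) \<delta> \<gamma>"
  shows "locally_hoelder M T Y \<gamma>"
proof -
  interpret prob_space M by fact
  have "(SUP (s, t) \<in> {(s, t). s \<in> {0..T} \<and> t \<in> {0..T} \<and> 0 < \<bar>t - s\<bar> \<and> \<bar>t - s\<bar> < \<eta> \<omega>}.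
      ereal (\<bar>Y t \<omega> - Y s \<omega>\<bar> / \<bar>t - s\<bar> powr \<gamma>)) \<le> ereal \<delta>" if "\<omega> \<in> space M" for \<omega>
    using path[OF that] by (intro SUP_least) (auto simp: hoelder_path_def divide_le_eq)
  then have "{\<omega> \<in> space M.
      (SUP (s, t) \<in> {(s, t). s \<in> {0..T} \<and> t \<in> {0..T} \<and> 0 < \<bar>t - s\<bar> \<and> \<bar>t - s\<bar> < \<eta> \<omega>}.
        ereal (\<bar>Y t \<omega> - Y s \<omega>\<bar> / \<bar>t - s\<bar> powr \<gamma>)) \<le> ereal \<delta>} = space M"
    by blast
  then show ?thesis
    unfolding locally_hoelder_def using assms by (intro bexI[of _ \<eta>] exI[of _ \<delta>]) (auto simp: prob_space)
qed

section \<open>Hoelder paths of multifractal processes\<close>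

lemma q_lower_le_0: "q_lower M T X \<le> 0"
  unfolding q_lower_def Let_def by (auto intro: INF_lower2)

text \<open>Places every index of the supremum \<open>H_minus\<close> in the range where \<tau> is
  tied to the moments.\<close>

lemma moment_rangeI: "0 < q \<Longrightarrow> ereal q < q_upper M T X \<Longrightarrow> q \<in> moment_range M T X"
  using q_lower_le_0[of M T X] by (auto simp: moment_range_def intro: le_less_trans)

lemma multifractal_AE_hoelder_path:
  assumes "prob_space M" "T > 0" and X: "stoch_process M T X" "multifractal M T X \<tau>"
    and q: "q > 0" "q \<in> moment_range M T X" and \<gamma>: "0 < \<gamma>" "\<gamma> < \<tau> q / q - 1 / q"
  obtains \<eta> \<delta> where "\<eta> \<in> borel_measurable M" "\<And>\<omega>. \<eta> \<omega> > 0" "\<delta> > 0"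
    "AE \<omega> in M. hoelder_path T (\<lambda>t. X t \<omega>) (\<eta> \<omega>) \<delta> \<gamma>"
proof -
  interpret prob_space M by fact
  obtain c where c: "c \<ge> 0"
    and mom: "\<And>s t. s \<in> {0..T} \<Longrightarrow> t \<in> {0..T} \<Longrightarrow> t \<noteq> s \<Longrightarrow>
      abs_moment M (\<lambda>\<omega>. X t \<omega> - X s \<omega>) q = ennreal (c * \<bar>t - s\<bar> powr \<tau> q)"
    using X(2) q(2) unfolding multifractal_def by blast
  interpret moment_increments M T X q "\<tau> q" c \<gamma>
  proof
    show "\<gamma> * q < \<tau> q - 1"
      using \<gamma> q by (simp add: field_simps)
    show "X t \<in> borel_measurable M" if "t \<in> {0..T}" for t
      using X(1) that by (auto simp: stoch_process_def intro: measurable_process_section)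
    \<comment> \<open>\<open>multifractal\<close> covers distinct times only. At
      \<open>s = t\<close> the moment is 0 because q > 0.\<close>
    show "abs_moment M (\<lambda>\<omega>. X t \<omega> - X s \<omega>) q \<le> ennreal (c * \<bar>t - s\<bar> powr \<tau> q)"
      if "s \<in> {0..T}" "t \<in> {0..T}" for s t
      using mom[OF that] q by (cases "s = t") (auto simp: abs_moment_def abs_pow_def)
  qed (use assms c in auto)
  show thesis
    using AE_hoelder X(1) that unfolding stoch_process_def hoelder_path_def by blast
qed

text \<open>If y < x, some rational lies strictly between them and is positive since y \<ge> 0.
  Countably many exponents thus suffice to reach H^-.\<close>

lemma ereal_le_of_rats:
  fixes x y :: ereal
  assumes "0 \<le> y" and "\<And>r. r \<in> \<rat> \<Longrightarrow> 0 < r \<Longrightarrow> ereal r < x \<Longrightarrow> ereal r \<le> y"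
  shows "x \<le> y"
proof (rule ccontr)
  assume "\<not> x \<le> y"
  then obtain a b :: real where ab: "y < ereal a" "ereal a < ereal b" "ereal b < x"
    by (metis ereal_dense2 not_le)
  then obtain r where "r \<in> \<rat>" "a < r" "r < b"
    using Rats_dense_in_real[of a b] by auto
  moreover have "0 < r"
    using ab(1) assms(1) \<open>a < r\<close> by (metis ereal_less(2) le_less_trans less_trans)
  moreover have "ereal r < x"
    using ab \<open>r < b\<close> by (metis less_ereal.simps(1) less_trans)
  ultimately have "ereal r \<le> y"
    using assms(2) by blast
  then show False
    using ab(1) \<open>a < r\<close> by (metis less_ereal.simps(1) less_trans not_le)
qed

section \<open>One modification for all exponents\<close>

theorem proposition1:
  fixes M :: "'a measure" and T :: real and X :: "real \<Rightarrow> 'a \<Rightarrow> real"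
    and \<tau> :: "real \<Rightarrow> real" and q :: real
  assumes "prob_space M"
    and "T > 0"
    and "stoch_process M T X"
    and "multifractal M T X \<tau>"
    and "q > 0"
    and "q \<in> moment_range M T X"
    and "abs_moment M (X T) q < \<infinity>"
    and "\<tau> q > 1"
  shows "(\<exists>Y. modification_of M T X Y \<and>
            (\<forall>\<gamma>\<in>{0<..<\<tau> q / q - 1 / q}. locally_hoelder M T Y \<gamma>)) \<and>
         (\<exists>Y. modification_of M T X Y \<and>
            (AE \<omega> in M. \<forall>t\<in>{0..T}.
               H_minus M T X \<tau> \<le> hoelder_exponent {0..T} (\<lambda>t. Y t \<omega>) t))"
proof -
  define R where "R = {r \<in> \<rat>. 0 < r \<and> ereal r < H_minus M T X \<tau>}"
  have "countable R"
    unfolding R_def by (rule countable_subset[OF _ countable_rat]) auto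
  define good where "good r \<eta> \<delta> N \<longleftrightarrow> \<eta> \<in> borel_measurable M \<and> (\<forall>\<omega>. \<eta> \<omega> > 0) \<and> \<delta> > 0 \<and>
      N \<in> null_sets M \<and> (\<forall>\<omega>\<in>space M - N. hoelder_path T (\<lambda>t. X t \<omega>) (\<eta> \<omega>) \<delta> r)" for r \<eta> \<delta> N
  have "\<exists>\<eta> \<delta> N. good r \<eta> \<delta> N" if "r \<in> R" for r
  proof -
    have r: "0 < r" "ereal r < H_minus M T X \<tau>"
      using that by (simp_all add: R_def)
    \<comment> \<open>An exponent below the supremum is beaten by a single term; the moment order
      \<open>p\<close> depends on \<open>r\<close> and may differ from \<open>q\<close>.\<close>
    then obtain p where p: "p \<in> {p. 0 < p \<and> ereal p < q_upper M T X \<and> \<tau> p > 1}"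
      and rp: "ereal r < ereal (\<tau> p / p - 1 / p)"
      unfolding H_minus_def less_SUP_iff by blast
    then have p_pos: "0 < p" and p_range: "p \<in> moment_range M T X" and "r < \<tau> p / p - 1 / p"
      by (simp_all add: moment_rangeI)
    then obtain \<eta> \<delta> where \<eta>: "\<eta> \<in> borel_measurable M" "\<And>\<omega>. \<eta> \<omega> > 0" "\<delta> > 0"
      and "AE \<omega> in M. hoelder_path T (\<lambda>t. X t \<omega>) (\<eta> \<omega>) \<delta> r"
      using multifractal_AE_hoelder_path[OF assms(1-4) p_pos p_range r(1)] by metis
    then obtain N where "N \<in> null_sets M"
      "\<forall>\<omega>\<in>space M - N. hoelder_path T (\<lambda>t. X t \<omega>) (\<eta> \<omega>) \<delta> r"
      using AE_Bex_null_set by blast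
    then show ?thesis
      unfolding good_def using \<eta> by blast
  qed
  then obtain \<eta> \<delta> N where good: "\<And>r. r \<in> R \<Longrightarrow> good r (\<eta> r) (\<delta> r) (N r)"
    by metis
  have \<eta>: "\<eta> r \<in> borel_measurable M" "\<And>\<omega>. \<eta> r \<omega> > 0" and \<delta>: "\<delta> r > 0" and N: "N r \<in> null_sets M"
    and path: "\<And>\<omega>. \<omega> \<in> space M - N r \<Longrightarrow> hoelder_path T (\<lambda>t. X t \<omega>) (\<eta> r \<omega>) (\<delta> r) r"
    if "r \<in> R" for r
    using good[OF that] unfolding good_def by blast+
  \<comment> \<open>The countable union is still null, so this single process serves both
    claims.\<close>
  define Y where "Y = off_null (\<Union>r\<in>R. N r) X"
  have "(\<Union>r\<in>R. N r) \<in> null_sets M"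
    using \<open>countable R\<close> N by (intro null_sets_UN') auto
  then have mod: "modification_of M T X Y"
    unfolding Y_def using assms by (intro modification_of_off_null) auto
  have Y_path: "hoelder_path T (\<lambda>t. Y t \<omega>) (\<eta> r \<omega>) (\<delta> r) r" if "r \<in> R" "\<omega> \<in> space M" for r \<omega>
  proof (cases "\<omega> \<in> (\<Union>r\<in>R. N r)")
    case True
    then show ?thesis
      using \<delta>[OF that(1)] by (simp add: Y_def off_null_def hoelder_path_def)
  next
    case False
    then have "(\<lambda>t. Y t \<omega>) = (\<lambda>t. X t \<omega>)" and "\<omega> \<in> space M - N r"
      using that by (auto simp: Y_def off_null_def)
    then show ?thesis
      using path[OF that(1)] by simp
  qed
  have "locally_hoelder M T Y \<gamma>" if "\<gamma> \<in> {0<..<\<tau> q / q - 1 / q}" for \<gamma>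
  proof -
    have \<gamma>: "0 < \<gamma>" "\<gamma> < \<tau> q / q - 1 / q"
      using that by (simp_all only: greaterThanLessThan_iff)
    \<comment> \<open>Since \<gamma> may be irrational, the estimate is taken from a larger rational
      exponent. It lies in \<open>R\<close> because \<tau>(q)/q - 1/q is one of the terms of the
      supremum H^-.\<close>
    obtain r where r: "r \<in> \<rat>" "\<gamma> < r" "r < \<tau> q / q - 1 / q"
      using Rats_dense_in_real[OF \<gamma>(2)] by blast
    have "q \<in> {q. 0 < q \<and> ereal q < q_upper M T X \<and> \<tau> q > 1}"
      using assms(5,6,8) by (simp add: moment_range_def)
    then have "ereal (\<tau> q / q - 1 / q) \<le> H_minus M T X \<tau>"
      unfolding H_minus_def by (rule SUP_upper)
    moreover have "ereal r < ereal (\<tau> q / q - 1 / q)"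
      using r(3) by (simp only: less_ereal.simps)
    ultimately have "ereal r < H_minus M T X \<tau>"
      by (rule less_le_trans[rotated])
    then have "r \<in> R"
      using r \<gamma>(1) by (simp add: R_def)
    then show ?thesis
      using \<eta>[of r] \<delta>[of r] r(2) assms(1) Y_path
      by (intro locally_hoelderI[of M "\<lambda>\<omega>. min (\<eta> r \<omega>) 1" "\<delta> r"] hoelder_path_mono[of _ _ _ _ r])
        simp_all
  qed
  moreover have "H_minus M T X \<tau> \<le> hoelder_exponent {0..T} (\<lambda>t. Y t \<omega>) t"
    if "\<omega> \<in> space M" "t \<in> {0..T}" for \<omega> t
  proof (rule ereal_le_of_rats)
    \<comment> \<open>Nonnegative in either case: a supremum of nonnegative numbers, or 0 by
      convention.\<close>
    show "0 \<le> hoelder_exponent {0..T} (\<lambda>t. Y t \<omega>) t"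
      by (auto simp: hoelder_exponent_def Let_def intro: Sup_upper2)
  next
    fix r assume "r \<in> \<rat>" "0 < r" "ereal r < H_minus M T X \<tau>"
    then have "r \<in> R"
      by (simp add: R_def)
    then show "ereal r \<le> hoelder_exponent {0..T} (\<lambda>t. Y t \<omega>) t"
      using that \<eta> \<delta> Y_path \<open>0 < r\<close>
      by (intro hoelder_exponent_ge hoelder_path_imp_hoelder_at[of _ _ "\<eta> r \<omega>" "\<delta> r"]) auto
  qed
  ultimately show ?thesis
    using mod by blast
qed

end
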